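(* Let $(\hat{x},\hat{y})\in\mathcal{S}\setminus\mathcal{F}$ be a basic feasible solution to the linear program $\min_{(x,y)\in\mathcal{P}} cx+d^1y$. Let $N=m_1+m_2+n_1+n_2$ and let $H\subseteq\{1,\dots,N\}$ consist of the indices of a set of $n_1+n_2$ linearly independent inequalities (including non-negativity) in the description of $\mathcal{P}$ that are binding at $(\hat{x},\hat{y})$. Let $u\in\mathbb{Q}^{N}$ (a row vector) be such that $u_i=0$ for $i\notin H$, $u_i>0$ for $i\in H$, and such that $(\alpha^x,\alpha^y,\beta)$ is a split disjunction, where $$(\alpha^x,\alpha^y)=u\begin{bmatrix} A^1 & G^1 \\ A^2 & G^2 \\ I & 0 \\ 0 & I \end{bmatrix},\qquad \beta=u\begin{bmatrix} b^1 \\ b^2 \\ 0 \\ 0 \end{bmatrix}+1 .$$ Then $$\alpha^x x+\alpha^y y\ge\beta\qquad\text{for all }(x,y)\in\mathcal{F}.$$ Furthermore, $\alpha^x\hat{x}+\alpha^y\hat{y}=\beta-1$, so the inequality is violated by $(\hat{x},\hat{y})$.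
   Context: Setting (mixed integer bilevel linear optimization). Let $X=\mathbb{Z}^{r_1}_+\times\mathbb{R}^{n_1-r_1}_+$ and $Y=\mathbb{Z}^{r_2}_+\times\mathbb{R}^{n_2-r_2}_+$ with $0\le r_1\le n_1$, $0\le r_2\le n_2$. The data are rational: $A^1\in\mathbb{Q}^{m_1\times n_1}$, $G^1\in\mathbb{Q}^{m_1\times n_2}$, $b^1\in\mathbb{Q}^{m_1}$, $A^2\in\mathbb{Q}^{m_2\times n_1}$, $G^2\in\mathbb{Q}^{m_2\times n_2}$, $b^2\in\mathbb{Q}^{m_2}$, $c\in\mathbb{Q}^{n_1}$, $d^1,d^2\in\mathbb{Q}^{n_2}$. For $x\in\mathbb{R}^{n_1}$ put $$\mathcal{P}_1(x)=\{y\in\mathbb{R}^{n_2}_+\mid G^1y\ge b^1-A^1x\},\qquad \mathcal{P}_2(x)=\{y\in\mathbb{R}^{n_2}_+\mid G^2y\ge b^2-A^2x\}.$$ Let $$\mathcal{P}=\{(x,y)\in\mathbb{R}^{n_1+n_2}_+\mid y\in\mathcal{P}_1(x)\cap\mathcal{P}_2(x)\},\qquad \mathcal{S}=\mathcal{P}\cap(X\times Y).$$ The description of $\mathcal{P}$ consists of the $N$ inequalities, indexed in this order: the $m_1$ rows of $A^1x+G^1y\ge b^1$, the $m_2$ rows of $A^2x+G^2y\ge b^2$, the $n_1$ inequalities $x\ge0$, and the $n_2$ inequalities $y\ge0$. Inequalities are called linearly independent if their coefficient vectors in $\mathbb{R}^{n_1+n_2}$ are. The rational reaction set is $\mathcal{R}(x)=\operatorname{argmin}\{d^2y\mid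 y\in\mathcal{P}_2(x)\cap Y\}$, and the bilevel feasible region is $$\mathcal{F}=\{(x,y)\in X\times Y\mid y\in\mathcal{P}_1(x)\cap\mathcal{R}(x)\}.$$ A triple $(\pi^x,\pi^y,\pi_0)$ is (i.e. defines) a split disjunction if $(\pi^x,\pi^y,\pi_0)\in\mathbb{Z}^{n_1+n_2+1}$, $\pi^x_i=0$ for $i\ge r_1+1$ and $\pi^y_i=0$ for $i\ge r_2+1$; the associated disjunction is $\{(x,y)\mid\pi^xx+\pi^yy\le\pi_0-1\}\cup\{(x,y)\mid\pi^xx+\pi^yy\ge\pi_0\}$. *)

theory Defs
  imports "Jordan_Normal_Form.VS_Connect"
begin

record miblp =
  n1 :: nat
  n2 :: nat
  r1 :: nat
  r2 :: nat
  m1 :: nat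
  m2 :: nat
  A1 :: "real mat"
  G1 :: "real mat"
  b1 :: "real vec"
  A2 :: "real mat"
  G2 :: "real mat"
  b2 :: "real vec"
  c :: "real vec"
  d1 :: "real vec"
  d2 :: "real vec"

text \<open>The data are rational, but live over the reals because the continuous variables are real.\<close>

definition rational_mat :: "nat \<Rightarrow> nat \<Rightarrow> real mat set" where
  "rational_mat m n = {A \<in> carrier_mat m n. elements_mat A \<subseteq> \<rat>}"

definition rational_vec :: "nat \<Rightarrow> real vec set" where
  "rational_vec n = {v \<in> carrier_vec n. set\<^sub>v v \<subseteq> \<rat>}"

definition integer_vec :: "nat \<Rightarrow> real vec set" where
  "integer_vec n = {v \<in> carrier_vec n. set\<^sub>v v \<subseteq> \<int>}"

definition nonneg_vec :: "nat \<Rightarrow> real vec set" where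
  "nonneg_vec n = {v \<in> carrier_vec n. v \<ge> 0\<^sub>v n}"

definition miblp_data :: "miblp \<Rightarrow> bool" where
  "miblp_data M \<longleftrightarrow>
     r1 M \<le> n1 M \<and> r2 M \<le> n2 M \<and>
     A1 M \<in> rational_mat (m1 M) (n1 M) \<and> G1 M \<in> rational_mat (m1 M) (n2 M) \<and>
     b1 M \<in> rational_vec (m1 M) \<and>
     A2 M \<in> rational_mat (m2 M) (n1 M) \<and> G2 M \<in> rational_mat (m2 M) (n2 M) \<and>
     b2 M \<in> rational_vec (m2 M) \<and>
     c M \<in> rational_vec (n1 M) \<and> d1 M \<in> rational_vec (n2 M) \<and> d2 M \<in> rational_vec (n2 M)"

text \<open>Vector components are indexed from 0, so the first \<open>r\<close> components are those with
  index \<open>i < r\<close>.\<close>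

definition mixed_integer_nonneg :: "nat \<Rightarrow> nat \<Rightarrow> real vec set" where
  "mixed_integer_nonneg r n = {v \<in> nonneg_vec n. \<forall>i<r. v $ i \<in> \<int>}"

definition X :: "miblp \<Rightarrow> real vec set" where
  "X M = mixed_integer_nonneg (r1 M) (n1 M)"

definition Y :: "miblp \<Rightarrow> real vec set" where
  "Y M = mixed_integer_nonneg (r2 M) (n2 M)"

definition P1 :: "miblp \<Rightarrow> real vec \<Rightarrow> real vec set" where
  "P1 M x = {y \<in> nonneg_vec (n2 M). G1 M *\<^sub>v y \<ge> b1 M - A1 M *\<^sub>v x}"

definition P2 :: "miblp \<Rightarrow> real vec \<Rightarrow> real vec set" where
  "P2 M x = {y \<in> nonneg_vec (n2 M). G2 M *\<^sub>v y \<ge> b2 M - A2 M *\<^sub>v x}"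

definition P :: "miblp \<Rightarrow> (real vec \<times> real vec) set" where
  "P M = {(x, y). x \<in> nonneg_vec (n1 M) \<and> y \<in> nonneg_vec (n2 M) \<and> y \<in> P1 M x \<inter> P2 M x}"

definition S :: "miblp \<Rightarrow> (real vec \<times> real vec) set" where
  "S M = P M \<inter> (X M \<times> Y M)"

definition reaction_set :: "miblp \<Rightarrow> real vec \<Rightarrow> real vec set" where
  "reaction_set M x = {y. is_arg_min (\<lambda>y. d2 M \<bullet> y) (\<lambda>y. y \<in> P2 M x \<inter> Y M) y}"

definition F :: "miblp \<Rightarrow> (real vec \<times> real vec) set" where
  "F M = {(x, y) \<in> X M \<times> Y M. y \<in> P1 M x \<inter> reaction_set M x}"

text \<open>All inequalities describing \<open>P M\<close>, in order, as \<open>constraint_mat M *\<^sub>v (x @\<^sub>v y) \<ge> constraint_rhs M\<close>.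
  They are indexed by \<open>{..<num_constraints M}\<close>, that is, from 0.\<close>

definition num_constraints :: "miblp \<Rightarrow> nat" where
  "num_constraints M = m1 M + m2 M + n1 M + n2 M"

definition constraint_mat :: "miblp \<Rightarrow> real mat" where
  "constraint_mat M =
     four_block_mat (A1 M) (G1 M) (A2 M) (G2 M) @\<^sub>r
     four_block_mat (1\<^sub>m (n1 M)) (0\<^sub>m (n1 M) (n2 M)) (0\<^sub>m (n2 M) (n1 M)) (1\<^sub>m (n2 M))"

definition constraint_rhs :: "miblp \<Rightarrow> real vec" where
  "constraint_rhs M = (b1 M @\<^sub>v b2 M) @\<^sub>v (0\<^sub>v (n1 M) @\<^sub>v 0\<^sub>v (n2 M))"

definition binding :: "miblp \<Rightarrow> nat \<Rightarrow> real vec \<times> real vec \<Rightarrow> bool" where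
  "binding M i = (\<lambda>(x, y). row (constraint_mat M) i \<bullet> (x @\<^sub>v y) = constraint_rhs M $ i)"

text \<open>Injectivity makes this independence of the family of coefficient vectors: two inequalities
  with the same coefficient vector are dependent.\<close>

definition lin_indpt_constraints :: "miblp \<Rightarrow> nat set \<Rightarrow> bool" where
  "lin_indpt_constraints M H \<longleftrightarrow>
     H \<subseteq> {..<num_constraints M} \<and> inj_on (row (constraint_mat M)) H \<and>
     LinearCombinations.module.lin_indpt class_ring (module_vec TYPE(real) (n1 M + n2 M))
       (row (constraint_mat M) ` H)"

definition binding_basis :: "miblp \<Rightarrow> nat set \<Rightarrow> real vec \<times> real vec \<Rightarrow> bool" where
  "binding_basis M H z \<longleftrightarrow>
     lin_indpt_constraints M H \<and> card H = n1 M + n2 M \<and> (\<forall>i\<in>H. binding M i z)"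

text \<open>Basic feasible solutions of the linear program minimizing \<open>c M \<bullet> x + d1 M \<bullet> y\<close> over
  \<open>P M\<close>. Being one depends only on the constraints of the program, not on its objective.\<close>

definition basic_feasible_solution :: "miblp \<Rightarrow> real vec \<times> real vec \<Rightarrow> bool" where
  "basic_feasible_solution M z \<longleftrightarrow> z \<in> P M \<and> (\<exists>H. binding_basis M H z)"

definition split_disjunction :: "miblp \<Rightarrow> real vec \<Rightarrow> real vec \<Rightarrow> real \<Rightarrow> bool" where
  "split_disjunction M \<pi>x \<pi>y \<pi>0 \<longleftrightarrow>
     \<pi>x \<in> integer_vec (n1 M) \<and> \<pi>y \<in> integer_vec (n2 M) \<and> \<pi>0 \<in> \<int> \<and>
     (\<forall>i. r1 M \<le> i \<and> i < n1 M \<longrightarrow> \<pi>x $ i = 0) \<and>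
     (\<forall>i. r2 M \<le> i \<and> i < n2 M \<longrightarrow> \<pi>y $ i = 0)"

end

theory Submission
  imports Defs
begin

text \<open>The cut comes from an integrality argument. Adding up the inequalities of \<open>H\<close> with the
  weights \<open>u\<close> gives the inequality \<open>\<alpha>x \<bullet> x + \<alpha>y \<bullet> y \<ge> \<beta> - 1\<close>, which is valid on \<open>P M\<close>. As the
  weights on \<open>H\<close> are positive, equality forces every inequality of \<open>H\<close> to be binding
  (\<open>weighted_constraints_bound\<close>, \<open>weighted_constraints_tight_iff\<close>). These inequalities have
  \<open>n1 M + n2 M\<close> independent coefficient vectors, so the only point at which all of them are
  binding is the vertex \<open>(x_hat, y_hat)\<close> (\<open>binding_basis_unique\<close>). Hence the left-hand side is
  equal to \<open>\<beta> - 1\<close> at the vertex and strictly greater at every other point of \<open>P M\<close>.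

  As \<open>(\<alpha>x, \<alpha>y, \<beta>)\<close> is a split disjunction, \<open>\<beta>\<close> is an integer and \<open>\<alpha>x \<bullet> x + \<alpha>y \<bullet> y\<close> takes
  integer values on \<open>X M \<times> Y M\<close> (\<open>split_disjunction_integral\<close>). So on \<open>S M\<close> without the vertex, strictly greater than
  \<open>\<beta> - 1\<close> means at least \<open>\<beta>\<close>. A bilevel feasible point lies in \<open>S M\<close> and is different from the
  vertex, which is bilevel infeasible.\<close>

section \<open>Weighted sums of linear inequalities\<close>

lemma (in vec_space) orthogonal_to_basis_imp_zero:
  assumes indpt: "lin_indpt B" and carrier: "B \<subseteq> carrier_vec n" and "finite B" "card B = n"
    and w: "w \<in> carrier_vec n" and orthogonal: "\<And>v. v \<in> B \<Longrightarrow> v \<bullet> w = 0"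
  shows "w = 0\<^sub>v n"
proof -
  have "basis B"
    using assms by (intro dim_li_is_basis) (auto simp: dim_is_n)
  then have span: "span B = carrier_vec n"
    by (simp add: basis_def)
  have "w \<in> orthogonal_complement B"
    unfolding orthogonal_complement_def
    using w orthogonal carrier by (auto simp: comm_scalar_prod[of w n] subset_iff)
  then have "w \<in> orthogonal_complement (carrier_vec n)"
    using in_orthogonal_complement_span[OF carrier] span by simp
  \<comment> \<open>The coordinates are the products with the unit vectors; \<open>w \<bullet> w = 0\<close> would not suffice over a
    general field.\<close>
  then have "w \<bullet> unit_vec n i = 0" for i
    unfolding orthogonal_complement_def by auto
  then have "w $ i = 0" if "i < n" for i
    using scalar_prod_right_unit[OF that, of w] by simp
  with w show ?thesis
    by (intro eq_vecI) auto
qed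

lemma weighted_constraints_slack:
  fixes A :: "'a::comm_ring_1 mat"
  assumes "A \<in> carrier_mat m n" "b \<in> carrier_vec m" "z \<in> carrier_vec n" "u \<in> carrier_vec m"
  shows "(transpose_mat A *\<^sub>v u) \<bullet> z - u \<bullet> b = (\<Sum>i<m. u $ i * (row A i \<bullet> z - b $ i))"
proof -
  have "(transpose_mat A *\<^sub>v u) \<bullet> z = u \<bullet> (A *\<^sub>v z)"
    using assms by (intro transpose_vec_mult_scalar)
  then show ?thesis
    using assms by (auto simp: scalar_prod_def atLeast0LessThan sum_subtractf right_diff_distrib)
qed

context
  fixes A :: "real mat" and b z u :: "real vec" and m n :: nat and H :: "nat set"
  assumes dims: "A \<in> carrier_mat m n" "b \<in> carrier_vec m" "z \<in> carrier_vec n" "u \<in> carrier_vec m"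
    and feasible: "A *\<^sub>v z \<ge> b"
    and support: "H \<subseteq> {..<m}" "\<And>i. i < m \<Longrightarrow> i \<notin> H \<Longrightarrow> u $ i = 0" "\<And>i. i \<in> H \<Longrightarrow> u $ i > 0"
begin

lemma weighted_slack_nonneg: "i < m \<Longrightarrow> u $ i * (row A i \<bullet> z - b $ i) \<ge> 0"
  using dims feasible support(2)[of i] support(3)[of i]
  by (cases "i \<in> H") (auto simp: less_eq_vec_def)

lemma weighted_constraints_bound: "(transpose_mat A *\<^sub>v u) \<bullet> z \<ge> u \<bullet> b"
proof -
  have "(\<Sum>i<m. u $ i * (row A i \<bullet> z - b $ i)) \<ge> 0"
    by (intro sum_nonneg weighted_slack_nonneg) simp
  then show ?thesis
    using weighted_constraints_slack[OF dims] by simp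
qed

text \<open>A sum of nonnegative terms vanishes only if each term does, and on \<open>H\<close> the positive weight
  can be cancelled.\<close>

lemma weighted_constraints_tight_iff:
  "(transpose_mat A *\<^sub>v u) \<bullet> z = u \<bullet> b \<longleftrightarrow> (\<forall>i\<in>H. row A i \<bullet> z = b $ i)"
proof -
  have "(transpose_mat A *\<^sub>v u) \<bullet> z = u \<bullet> b \<longleftrightarrow> (\<Sum>i<m. u $ i * (row A i \<bullet> z - b $ i)) = 0"
    unfolding weighted_constraints_slack[OF dims, symmetric] by simp
  also have "\<dots> \<longleftrightarrow> (\<forall>i<m. u $ i * (row A i \<bullet> z - b $ i) = 0)"
    by (subst sum_nonneg_eq_0_iff) (auto intro: weighted_slack_nonneg)
  also have "\<dots> \<longleftrightarrow> (\<forall>i\<in>H. row A i \<bullet> z = b $ i)"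
    using support by (force simp: subset_iff)
  finally show ?thesis .
qed

end

section \<open>The constraint system of a bilevel program\<close>

lemma constraint_mat_carrier:
  assumes "miblp_data M"
  shows "constraint_mat M \<in> carrier_mat (num_constraints M) (n1 M + n2 M)"
proof -
  have "constraint_mat M \<in> carrier_mat ((m1 M + m2 M) + (n1 M + n2 M)) (n1 M + n2 M)"
    unfolding constraint_mat_def using assms
    by (intro carrier_append_rows) (auto simp: miblp_data_def rational_mat_def)
  then show ?thesis
    by (simp add: num_constraints_def add.assoc)
qed

lemma constraint_rhs_carrier:
  assumes "miblp_data M"
  shows "constraint_rhs M \<in> carrier_vec (num_constraints M)"
proof -
  have "b1 M \<in> carrier_vec (m1 M)" "b2 M \<in> carrier_vec (m2 M)"
    using assms by (simp_all add: miblp_data_def rational_vec_def)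
  then have "constraint_rhs M \<in> carrier_vec ((m1 M + m2 M) + (n1 M + n2 M))"
    unfolding constraint_rhs_def by (intro append_carrier_vec zero_carrier_vec)
  then show ?thesis
    by (simp add: num_constraints_def add.assoc)
qed

lemma P_carrier:
  assumes "(x, y) \<in> P M"
  shows "x \<in> carrier_vec (n1 M)" "y \<in> carrier_vec (n2 M)"
  using assms by (auto simp: P_def nonneg_vec_def)

lemma P_imp_constraints:
  assumes "miblp_data M" "(x, y) \<in> P M"
  shows "constraint_mat M *\<^sub>v (x @\<^sub>v y) \<ge> constraint_rhs M"
proof -
  have data:
    "A1 M \<in> carrier_mat (m1 M) (n1 M)" "G1 M \<in> carrier_mat (m1 M) (n2 M)" "b1 M \<in> carrier_vec (m1 M)"
    "A2 M \<in> carrier_mat (m2 M) (n1 M)" "G2 M \<in> carrier_mat (m2 M) (n2 M)" "b2 M \<in> carrier_vec (m2 M)"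
    using assms(1) by (auto simp: miblp_data_def rational_mat_def rational_vec_def)
  note xy = P_carrier[OF assms(2)]
  have append: "constraint_mat M *\<^sub>v (x @\<^sub>v y) =
      ((A1 M *\<^sub>v x + G1 M *\<^sub>v y) @\<^sub>v (A2 M *\<^sub>v x + G2 M *\<^sub>v y)) @\<^sub>v (x @\<^sub>v y)"
  proof -
    have "constraint_mat M *\<^sub>v (x @\<^sub>v y) =
        (four_block_mat (A1 M) (G1 M) (A2 M) (G2 M) *\<^sub>v (x @\<^sub>v y)) @\<^sub>v
        (four_block_mat (1\<^sub>m (n1 M)) (0\<^sub>m (n1 M) (n2 M)) (0\<^sub>m (n2 M) (n1 M)) (1\<^sub>m (n2 M)) *\<^sub>v (x @\<^sub>v y))"
      unfolding constraint_mat_def using data xy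
      by (intro mat_mult_append[of _ "m1 M + m2 M" "n1 M + n2 M" _ "n1 M + n2 M"]) auto
    then show ?thesis
      using data xy
      by (simp add: four_block_mat_mult_vec[of _ "m1 M" "n1 M" _ "n2 M" _ "m2 M"]
          four_block_mat_mult_vec[of _ "n1 M" "n1 M" _ "n2 M" _ "n2 M"])
  qed
  have "b1 M - A1 M *\<^sub>v x \<le> G1 M *\<^sub>v y" "b2 M - A2 M *\<^sub>v x \<le> G2 M *\<^sub>v y"
    and nonneg: "0\<^sub>v (n1 M) \<le> x" "0\<^sub>v (n2 M) \<le> y"
    using assms(2) by (auto simp: P_def P1_def P2_def nonneg_vec_def)
  then have "b1 M \<le> A1 M *\<^sub>v x + G1 M *\<^sub>v y" "b2 M \<le> A2 M *\<^sub>v x + G2 M *\<^sub>v y"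
    using data by (auto simp: less_eq_vec_def algebra_simps)
  then show ?thesis
    unfolding append constraint_rhs_def using data nonneg
    by (simp add: append_vec_le[of _ "m1 M + m2 M"] append_vec_le[of _ "m1 M"]
        append_vec_le[of _ "n1 M"] xy)
qed

lemma minus_vec_eq_zero_imp_eq:
  fixes v w :: "'a::group_add vec"
  assumes "v \<in> carrier_vec n" "w \<in> carrier_vec n" "v - w = 0\<^sub>v n"
  shows "v = w"
  using assms by (auto simp: vec_eq_iff)

text \<open>The difference of two points at which the basis is binding is orthogonal to its coefficient
  vectors, and these span the space.\<close>

lemma binding_basis_unique:
  assumes data: "miblp_data M" and basis: "binding_basis M H (x', y')"
    and carrier': "x' \<in> carrier_vec (n1 M)" "y' \<in> carrier_vec (n2 M)"
    and carrier: "x \<in> carrier_vec (n1 M)" "y \<in> carrier_vec (n2 M)"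
    and binding: "\<And>i. i \<in> H \<Longrightarrow> binding M i (x, y)"
  shows "(x, y) = (x', y')"
proof -
  interpret vec_space "TYPE(real)" "n1 M + n2 M" .
  let ?C = "constraint_mat M" and ?n = "n1 M + n2 M"
  let ?z = "x @\<^sub>v y" and ?z' = "x' @\<^sub>v y'"
  have H: "H \<subseteq> {..<num_constraints M}" "inj_on (row ?C) H" "lin_indpt (row ?C ` H)" "card H = ?n"
    using basis by (auto simp: binding_basis_def lin_indpt_constraints_def)
  have z: "?z \<in> carrier_vec ?n" "?z' \<in> carrier_vec ?n"
    using carrier carrier' by auto
  have rows: "row ?C i \<in> carrier_vec ?n" for i
    using row_carrier[of ?C i] carrier_matD(2)[OF constraint_mat_carrier[OF data]] by metis
  have "?z - ?z' = 0\<^sub>v ?n"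
  proof (rule orthogonal_to_basis_imp_zero[OF H(3)])
    show "finite (row ?C ` H)"
      using H(1) finite_subset by blast
    show "card (row ?C ` H) = ?n"
      using H by (simp add: card_image)
    fix v assume "v \<in> row ?C ` H"
    then obtain i where "i \<in> H" "v = row ?C i" by blast
    moreover from this have "row ?C i \<bullet> ?z = constraint_rhs M $ i" "row ?C i \<bullet> ?z' = constraint_rhs M $ i"
      using binding basis by (auto simp: binding_def binding_basis_def)
    ultimately show "v \<bullet> (?z - ?z') = 0"
      using scalar_prod_minus_distrib[OF rows z] by simp
  qed (use z rows in auto)
  then have "?z = ?z'"
    by (rule minus_vec_eq_zero_imp_eq[OF z])
  then show ?thesis
    using carrier carrier' by simp
qed

section \<open>Integrality and bilevel feasibility\<close>

text \<open>In each term of the product, the component of \<open>x\<close> is an integer or its coefficient is zero.\<close>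

lemma mixed_integer_scalar_prod_integral:
  assumes "x \<in> mixed_integer_nonneg r n" "a \<in> integer_vec n" "\<forall>i. r \<le> i \<and> i < n \<longrightarrow> a $ i = 0"
  shows "a \<bullet> x \<in> \<int>"
proof -
  have "a $ i * x $ i \<in> \<int>" if "i < n" for i
    using that assms by (cases "i < r")
      (auto simp: mixed_integer_nonneg_def integer_vec_def subset_iff vec_setI intro!: Ints_mult)
  moreover have "dim_vec x = n"
    using assms(1) by (auto simp: mixed_integer_nonneg_def nonneg_vec_def)
  ultimately show ?thesis
    unfolding scalar_prod_def by (intro Ints_sum) simp
qed

lemma split_disjunction_integral:
  assumes "split_disjunction M \<pi>x \<pi>y \<pi>0" "x \<in> X M" "y \<in> Y M"
  shows "\<pi>x \<bullet> x + \<pi>y \<bullet> y \<in> \<int>"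
  using assms unfolding split_disjunction_def X_def Y_def
  by (intro Ints_add; elim conjE) (rule mixed_integer_scalar_prod_integral; assumption)+

text \<open>A reaction is a minimizer over \<open>P2 M x \<inter> Y M\<close>, so it satisfies the second-level constraints.\<close>

lemma F_subset_S: "F M \<subseteq> S M"
proof (rule subrelI)
  fix x y assume "(x, y) \<in> F M"
  then have "x \<in> X M" "y \<in> Y M" "y \<in> P1 M x" "y \<in> P2 M x"
    by (simp_all add: F_def reaction_set_def is_arg_min_def)
  then show "(x, y) \<in> S M"
    by (simp add: S_def P_def X_def Y_def mixed_integer_nonneg_def)
qed

lemma Ints_less_imp_add_one_le:
  fixes a b :: "'a::linordered_idom"
  assumes "a \<in> \<int>" "b \<in> \<int>" "a < b"
  shows "a + 1 \<le> b"
proof -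
  obtain i j where "a = of_int i" "b = of_int j"
    using assms(1,2) by (auto elim!: Ints_cases)
  with assms(3) have "a + 1 = of_int (i + 1)" "i + 1 \<le> j"
    by simp_all
  then show ?thesis
    using \<open>b = of_int j\<close> by (simp only: of_int_le_iff)
qed

section \<open>Validity of the cut\<close>

theorem theorem3:
  fixes M :: miblp
    and x_hat y_hat u \<alpha>x \<alpha>y :: "real vec"
    and \<beta> :: real
    and H :: "nat set"
  assumes "miblp_data M"
    and "(x_hat, y_hat) \<in> S M - F M"
    and "basic_feasible_solution M (x_hat, y_hat)"
    and "binding_basis M H (x_hat, y_hat)"
    and "u \<in> rational_vec (num_constraints M)"
    and "\<And>i. i < num_constraints M \<Longrightarrow> i \<notin> H \<Longrightarrow> u $ i = 0"
    and "\<And>i. i \<in> H \<Longrightarrow> u $ i > 0"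
    and "\<alpha>x @\<^sub>v \<alpha>y = transpose_mat (constraint_mat M) *\<^sub>v u"
    and "\<beta> = u \<bullet> constraint_rhs M + 1"
    and "split_disjunction M \<alpha>x \<alpha>y \<beta>"
  shows "(\<forall>(x, y) \<in> F M. \<alpha>x \<bullet> x + \<alpha>y \<bullet> y \<ge> \<beta>) \<and>
    \<alpha>x \<bullet> x_hat + \<alpha>y \<bullet> y_hat = \<beta> - 1 \<and>
    \<alpha>x \<bullet> x_hat + \<alpha>y \<bullet> y_hat < \<beta>"
proof -
  let ?C = "constraint_mat M" and ?d = "constraint_rhs M"
  have u: "u \<in> carrier_vec (num_constraints M)"
    using assms(5) by (simp add: rational_vec_def)
  have H: "H \<subseteq> {..<num_constraints M}"
    using assms(4) unfolding binding_basis_def lin_indpt_constraints_def by (elim conjE)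
  have \<alpha>: "\<alpha>x \<in> carrier_vec (n1 M)" "\<alpha>y \<in> carrier_vec (n2 M)"
    using assms(10) by (simp_all add: split_disjunction_def integer_vec_def)
  have hat: "(x_hat, y_hat) \<in> P M" "(x_hat, y_hat) \<notin> F M"
    using assms(2) by (simp_all add: S_def)
  have lhs: "\<alpha>x \<bullet> x + \<alpha>y \<bullet> y = (transpose_mat ?C *\<^sub>v u) \<bullet> (x @\<^sub>v y)" if "(x, y) \<in> P M" for x y
    unfolding assms(8)[symmetric] by (rule scalar_prod_append[OF \<alpha> P_carrier[OF that], symmetric])
  have dims: "?C \<in> carrier_mat (num_constraints M) (n1 M + n2 M)" "?d \<in> carrier_vec (num_constraints M)"
    "x @\<^sub>v y \<in> carrier_vec (n1 M + n2 M)" "u \<in> carrier_vec (num_constraints M)"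
    if "(x, y) \<in> P M" for x y
    using constraint_mat_carrier[OF assms(1)] constraint_rhs_carrier[OF assms(1)] P_carrier[OF that] u
    by simp_all
  have bound: "\<alpha>x \<bullet> x + \<alpha>y \<bullet> y \<ge> \<beta> - 1" if "(x, y) \<in> P M" for x y
    using weighted_constraints_bound[OF dims[OF that] P_imp_constraints[OF assms(1) that] H assms(6,7)]
      lhs[OF that] assms(9) by simp
  have tight: "\<alpha>x \<bullet> x + \<alpha>y \<bullet> y = \<beta> - 1 \<longleftrightarrow> (\<forall>i\<in>H. binding M i (x, y))" if "(x, y) \<in> P M" for x y
    using weighted_constraints_tight_iff[OF dims[OF that] P_imp_constraints[OF assms(1) that] H assms(6,7)]
      lhs[OF that] assms(9) by (simp add: binding_def)
  have at_hat: "\<alpha>x \<bullet> x_hat + \<alpha>y \<bullet> y_hat = \<beta> - 1"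
    using tight[OF hat(1)] assms(4) by (simp add: binding_basis_def)
  have cut: "\<alpha>x \<bullet> x + \<alpha>y \<bullet> y \<ge> \<beta>" if xy: "(x, y) \<in> F M" for x y
  proof -
    have feasible: "(x, y) \<in> P M" and mixed: "x \<in> X M" "y \<in> Y M"
      using subsetD[OF F_subset_S xy] by (simp_all add: S_def)
    have "\<alpha>x \<bullet> x + \<alpha>y \<bullet> y \<noteq> \<beta> - 1"
    proof
      assume "\<alpha>x \<bullet> x + \<alpha>y \<bullet> y = \<beta> - 1"
      then have "\<forall>i\<in>H. binding M i (x, y)"
        by (simp only: tight[OF feasible])
      then have "(x, y) = (x_hat, y_hat)"
        by (intro binding_basis_unique[OF assms(1,4) P_carrier[OF hat(1)] P_carrier[OF feasible]])
          (rule bspec)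
      then show False
        using xy hat(2) by simp
    qed
    then have "\<beta> - 1 < \<alpha>x \<bullet> x + \<alpha>y \<bullet> y"
      using bound[OF feasible] by simp
    then have "\<beta> - 1 + 1 \<le> \<alpha>x \<bullet> x + \<alpha>y \<bullet> y"
      using split_disjunction_integral[OF assms(10) mixed] assms(10)
      by (intro Ints_less_imp_add_one_le) (simp_all add: split_disjunction_def)
    then show ?thesis
      by simp
  qed
  show ?thesis
    using cut at_hat by auto
qed

end
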